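(* Consider the reallocation problem (defined in the context) restricted to instances with $d^+(w)=d^-(w)=+\infty$ for every warehouse $w\in W$ (product sizes, transit times and warehouse capacities arbitrary, subject to the standing assumptions). Then a feasible schedule of minimum completion time can be computed in ${\mathrm O}(m+n)$ time, where $m=|P|$ and $n=|W|$.
   Context: Reallocation problem. An instance consists of a finite set $W$ of warehouses ($n=|W|$) and a finite set $P$ of products ($m=|P|$). Each product $p$ has a size ${\it size}(p)\ge 0$, a source warehouse $s(p)\in W$ and a sink warehouse $t(p)\in W$ with $s(p)\ne t(p)$, and a transit time $\tau(p)\in\mathbb{Z}_{>0}$. Each warehouse $w$ has a warehouse capacity $c(w)$, a carry-out capacity $d^+(w)$ and a carry-in capacity $d^-(w)$, each a nonnegative real or $+\infty$ (meaning the corresponding constraint is vacuous). Let $P^+(w)=\{p\in P: s(p)=w\}$ and $P^-(w)=\{p\in P: t(p)=w\}$. Standing assumptions: ${\it size}(p)\le d^+(w)$ for all $p\in P^+(w)$, ${\it size}(p)\le d^-(w)$ for all $p\in P^-(w)$, $\sum_{p\in P^+(w)}{\it size}(p)\le c(w)$ and $\sum_{p\in P^-(w)}{\it size}(p)\le c(w)$ for all $w$. A schedule is a map $\varphi:P\to\mathbb{Z}_{\ge 0}$ (product $p$ leaves $s(p)$ at time $\varphi(p)$ and arrives at $t(p)$ at time $\varphi(p)+\tau(p)$). It is feasible if for every $\theta\in\mathbb{Z}_{\ge0}$ and every $w\in W$: (i) $\sum_{p\in P^+(w):\varphi(p)=\theta}{\it size}(p)\le d^+(w)$; (ii) $\sum_{p\in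 P^-(w):\varphi(p)=\theta-\tau(p)}{\it size}(p)\le d^-(w)$; (iii) $\sum_{p\in P^+(w):\varphi(p)\ge\theta}{\it size}(p)+\sum_{p\in P^-(w):\varphi(p)\le\theta-\tau(p)}{\it size}(p)\le c(w)$. The completion time of $\varphi$ is $\max_{p\in P}(\varphi(p)+\tau(p))$. The reallocation problem asks for a feasible schedule of minimum completion time. *)

theory Defs
  imports Complex_Main "HOL-Library.Extended_Real" "HOL-Library.Landau_Symbols"
begin

section \<open>The reallocation problem\<close>

record ('w, 'p) reallocation =
  warehouses :: "'w set"
  products :: "'p set"
  psize :: "'p \<Rightarrow> real"
  source :: "'p \<Rightarrow> 'w"
  sink :: "'p \<Rightarrow> 'w"
  transit :: "'p \<Rightarrow> nat"
  cap :: "'w \<Rightarrow> ereal"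
  cap_out :: "'w \<Rightarrow> ereal"
  cap_in :: "'w \<Rightarrow> ereal"

definition prods_from :: "('w, 'p) reallocation \<Rightarrow> 'w \<Rightarrow> 'p set" where
  "prods_from I w = {p \<in> products I. source I p = w}"

definition prods_to :: "('w, 'p) reallocation \<Rightarrow> 'w \<Rightarrow> 'p set" where
  "prods_to I w = {p \<in> products I. sink I p = w}"

definition valid_instance :: "('w, 'p) reallocation \<Rightarrow> bool" where
  "valid_instance I \<longleftrightarrow>
     finite (warehouses I) \<and> finite (products I) \<and>
     (\<forall>p\<in>products I. 0 \<le> psize I p \<and> 0 < transit I p \<and>
        source I p \<in> warehouses I \<and> sink I p \<in> warehouses I \<and> source I p \<noteq> sink I p) \<and>
     (\<forall>w\<in>warehouses I. 0 \<le> cap I w \<and> 0 \<le> cap_out I w \<and> 0 \<le> cap_in I w \<and>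
        (\<forall>p\<in>prods_from I w. ereal (psize I p) \<le> cap_out I w) \<and>
        (\<forall>p\<in>prods_to I w. ereal (psize I p) \<le> cap_in I w) \<and>
        ereal (\<Sum>p\<in>prods_from I w. psize I p) \<le> cap I w \<and>
        ereal (\<Sum>p\<in>prods_to I w. psize I p) \<le> cap I w)"

text \<open>A schedule is a function on the type of products of which only the values on
  \<^term>\<open>products I\<close> matter. Conditions on \<open>\<theta> - \<tau>(p)\<close>, which may be negative, are stated with
  \<open>\<tau>(p)\<close> on the other side.\<close>

definition feasible :: "('w, 'p) reallocation \<Rightarrow> ('p \<Rightarrow> nat) \<Rightarrow> bool" where
  "feasible I \<phi> \<longleftrightarrow> (\<forall>\<theta>. \<forall>w\<in>warehouses I.
     ereal (\<Sum>p | p \<in> prods_from I w \<and> \<phi> p = \<theta>. psize I p) \<le> cap_out I w \<and>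
     ereal (\<Sum>p | p \<in> prods_to I w \<and> \<phi> p + transit I p = \<theta>. psize I p) \<le> cap_in I w \<and>
     ereal ((\<Sum>p | p \<in> prods_from I w \<and> \<theta> \<le> \<phi> p. psize I p) +
            (\<Sum>p | p \<in> prods_to I w \<and> \<phi> p + transit I p \<le> \<theta>. psize I p)) \<le> cap I w)"

text \<open>The inserted 0 only fixes the value for an instance without products.\<close>

definition completion_time :: "('w, 'p) reallocation \<Rightarrow> ('p \<Rightarrow> nat) \<Rightarrow> nat" where
  "completion_time I \<phi> = Max (insert 0 ((\<lambda>p. \<phi> p + transit I p) ` products I))"

definition optimal_schedule :: "('w, 'p) reallocation \<Rightarrow> ('p \<Rightarrow> nat) \<Rightarrow> bool" where
  "optimal_schedule I \<phi> \<longleftrightarrow> feasible I \<phi> \<and>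
     (\<forall>\<psi>. feasible I \<psi> \<longrightarrow> completion_time I \<phi> \<le> completion_time I \<psi>)"


section \<open>A unit-cost random access machine over integers and reals\<close>

text \<open>
  The machine has an integer memory and a real memory (both initially zero, both addressed by
  integers), read-only random access to an input consisting of an integer array and a real array,
  and a write-only output to which integers are appended. Arithmetic is restricted to addition
  and subtraction, so that unit cost cannot be exploited by multiplication, and all constants are
  integers, so that no information can be hidden in a real constant. A program is a finite list
  of instructions; the machine halts when the program counter leaves that list.
\<close>

datatype instr =
    IConst int int
  | IAdd int int int
  | ISub int int int
  | ILoad int int
  | IStore int int
  | IRead int int
  | RConst int int
  | RAdd int int int
  | RSub int int int
  | RLoad int int
  | RStore int int
  | RRead int int
  | Goto nat
  | IfIPos int nat
  | IfRPos int nat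
  | Write int

record ram_state =
  pc :: nat
  imem :: "int \<Rightarrow> int"
  rmem :: "int \<Rightarrow> real"
  outp :: "int list"

definition lookup :: "'a::zero list \<Rightarrow> int \<Rightarrow> 'a" where
  "lookup xs k = (if 0 \<le> k \<and> nat k < length xs then xs ! nat k else 0)"

definition set_imem :: "int \<Rightarrow> int \<Rightarrow> ram_state \<Rightarrow> ram_state" where
  "set_imem a v s = s\<lparr>pc := Suc (pc s), imem := (imem s)(a := v)\<rparr>"

definition set_rmem :: "int \<Rightarrow> real \<Rightarrow> ram_state \<Rightarrow> ram_state" where
  "set_rmem a v s = s\<lparr>pc := Suc (pc s), rmem := (rmem s)(a := v)\<rparr>"

fun exec :: "int list \<Rightarrow> real list \<Rightarrow> instr \<Rightarrow> ram_state \<Rightarrow> ram_state" where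
  "exec xs ys (IConst a k) s = set_imem a k s"
| "exec xs ys (IAdd a b c) s = set_imem a (imem s b + imem s c) s"
| "exec xs ys (ISub a b c) s = set_imem a (imem s b - imem s c) s"
| "exec xs ys (ILoad a b) s = set_imem a (imem s (imem s b)) s"
| "exec xs ys (IStore a b) s = set_imem (imem s a) (imem s b) s"
| "exec xs ys (IRead a b) s = set_imem a (lookup xs (imem s b)) s"
| "exec xs ys (RConst a k) s = set_rmem a (of_int k) s"
| "exec xs ys (RAdd a b c) s = set_rmem a (rmem s b + rmem s c) s"
| "exec xs ys (RSub a b c) s = set_rmem a (rmem s b - rmem s c) s"
| "exec xs ys (RLoad a b) s = set_rmem a (rmem s (imem s b)) s"
| "exec xs ys (RStore a b) s = set_rmem (imem s a) (rmem s b) s"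
| "exec xs ys (RRead a b) s = set_rmem a (lookup ys (imem s b)) s"
| "exec xs ys (Goto l) s = s\<lparr>pc := l\<rparr>"
| "exec xs ys (IfIPos a l) s = s\<lparr>pc := (if 0 < imem s a then l else Suc (pc s))\<rparr>"
| "exec xs ys (IfRPos a l) s = s\<lparr>pc := (if 0 < rmem s a then l else Suc (pc s))\<rparr>"
| "exec xs ys (Write a) s = s\<lparr>pc := Suc (pc s), outp := outp s @ [imem s a]\<rparr>"

definition halted :: "instr list \<Rightarrow> ram_state \<Rightarrow> bool" where
  "halted Q s \<longleftrightarrow> length Q \<le> pc s"

definition step :: "instr list \<Rightarrow> int list \<Rightarrow> real list \<Rightarrow> ram_state \<Rightarrow> ram_state" where
  "step Q xs ys s = (if halted Q s then s else exec xs ys (Q ! pc s) s)"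

definition init_state :: ram_state where
  "init_state = \<lparr>pc = 0, imem = (\<lambda>_. 0), rmem = (\<lambda>_. 0), outp = []\<rparr>"

definition outputs_within ::
    "instr list \<Rightarrow> int list \<Rightarrow> real list \<Rightarrow> nat \<Rightarrow> int list \<Rightarrow> bool" where
  "outputs_within Q xs ys t zs \<longleftrightarrow>
     (let s = (step Q xs ys ^^ t) init_state in halted Q s \<and> outp s = zs)"


section \<open>Encoding of instances\<close>

text \<open>
  Warehouses and products are presented to the machine as positions in enumerations \<open>ws\<close> and \<open>ps\<close>.
  The integer array holds the numbers of warehouses and products, then source, sink and transit
  time of each product, then for each warehouse three flags telling which of its capacities are
  infinite. The real array holds the product sizes, then three capacities for each warehouse,
  infinite ones being replaced by 0 (the value of \<^const>\<open>real_of_ereal\<close>).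
\<close>

definition enumerates :: "'a list \<Rightarrow> 'a set \<Rightarrow> bool" where
  "enumerates xs A \<longleftrightarrow> distinct xs \<and> set xs = A"

definition position :: "'a list \<Rightarrow> 'a \<Rightarrow> nat" where
  "position xs x = length (takeWhile (\<lambda>y. y \<noteq> x) xs)"

definition inf_flag :: "ereal \<Rightarrow> int" where
  "inf_flag c = (if c = \<infinity> then 1 else 0)"

definition int_input :: "('w, 'p) reallocation \<Rightarrow> 'w list \<Rightarrow> 'p list \<Rightarrow> int list" where
  "int_input I ws ps =
     [int (length ws), int (length ps)] @
     concat (map (\<lambda>p. [int (position ws (source I p)), int (position ws (sink I p)),
                        int (transit I p)]) ps) @
     concat (map (\<lambda>w. [inf_flag (cap I w), inf_flag (cap_out I w), inf_flag (cap_in I w)]) ws)"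

definition real_input :: "('w, 'p) reallocation \<Rightarrow> 'w list \<Rightarrow> 'p list \<Rightarrow> real list" where
  "real_input I ws ps =
     map (psize I) ps @
     concat (map (\<lambda>w. [real_of_ereal (cap I w), real_of_ereal (cap_out I w),
                        real_of_ereal (cap_in I w)]) ws)"

end

theory Submission
  imports Defs
begin

text \<open>
  Without carry-in and carry-out limits all products can leave at time 0. At time 0 nothing has
  arrived yet, since transit times are positive, so a warehouse holds exactly its outgoing
  products; from time 1 on nothing is left to leave, so it holds at most its incoming products.
  Both loads respect the capacity by the standing assumptions. No schedule completes before the
  largest transit time, so it only remains to write one zero per product.
\<close>

lemma feasible_zero:
  assumes "valid_instance I"
    and "\<forall>w\<in>warehouses I. cap_out I w = \<infinity> \<and> cap_in I w = \<infinity>"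
  shows "feasible I (\<lambda>_. 0)"
  unfolding feasible_def
proof (intro allI ballI conjI)
  fix \<theta> w
  assume w: "w \<in> warehouses I"
  show "ereal (\<Sum>p | p \<in> prods_from I w \<and> 0 = \<theta>. psize I p) \<le> cap_out I w"
    and "ereal (\<Sum>p | p \<in> prods_to I w \<and> 0 + transit I p = \<theta>. psize I p) \<le> cap_in I w"
    using assms(2) w by auto
  have loads: "ereal (\<Sum>p\<in>prods_from I w. psize I p) \<le> cap I w"
    "ereal (\<Sum>p\<in>prods_to I w. psize I p) \<le> cap I w"
    using assms(1) w by (auto simp: valid_instance_def)
  show "ereal ((\<Sum>p | p \<in> prods_from I w \<and> \<theta> \<le> 0. psize I p) +
          (\<Sum>p | p \<in> prods_to I w \<and> 0 + transit I p \<le> \<theta>. psize I p)) \<le> cap I w"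
  proof (cases "\<theta> = 0")
    case True
    then have "{p. p \<in> prods_to I w \<and> 0 + transit I p \<le> \<theta>} = {}"
      using assms(1) by (auto simp: valid_instance_def prods_to_def)
    then show ?thesis using loads(1) True by (simp only: sum.empty) simp
  next
    case False
    \<comment> \<open>Dropping the products still under way cannot increase the sum, since sizes are
      nonnegative.\<close>
    have "(\<Sum>p | p \<in> prods_to I w \<and> 0 + transit I p \<le> \<theta>. psize I p)
        \<le> (\<Sum>p\<in>prods_to I w. psize I p)"
      using assms(1) by (intro sum_mono2) (auto simp: valid_instance_def prods_to_def)
    then show ?thesis using loads(2) False by (simp add: order_trans[rotated])
  qed
qed

lemma completion_time_zero_le:
  assumes "finite (products I)"
  shows "completion_time I (\<lambda>_. 0) \<le> completion_time I \<psi>"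
  unfolding completion_time_def
proof (rule Max.boundedI)
  fix t
  assume "t \<in> insert 0 ((\<lambda>p. 0 + transit I p) ` products I)"
  \<comment> \<open>The case \<open>t = 0\<close> comes from the inserted 0, which covers instances
    without products.\<close>
  then consider "t = 0" | p where "p \<in> products I" "t = transit I p" by auto
  then show "t \<le> Max (insert 0 ((\<lambda>p. \<psi> p + transit I p) ` products I))"
  proof cases
    case 2
    then have "t \<le> \<psi> p + transit I p" by simp
    then show ?thesis using assms 2(1) by (auto intro: Max_ge order_trans)
  qed simp
qed (use assms in auto)

lemma optimal_schedule_zero:
  assumes "valid_instance I"
    and "\<forall>w\<in>warehouses I. cap_out I w = \<infinity> \<and> cap_in I w = \<infinity>"
  shows "optimal_schedule I (\<lambda>_. 0)"
  using feasible_zero[OF assms] completion_time_zero_le assms(1)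
  by (auto simp: optimal_schedule_def valid_instance_def)

text \<open>A halted state is a fixed point of \<open>step\<close>, so surplus time is harmless.
  This permits a bound in m + n although the run length depends on m alone.\<close>

lemma outputs_within_mono:
  assumes "outputs_within Q xs ys t zs" and "t \<le> t'"
  shows "outputs_within Q xs ys t' zs"
proof -
  have "(step Q xs ys ^^ k) s = s" if "halted Q s" for k s
    using that by (induction k) (auto simp: step_def)
  moreover have "(step Q xs ys ^^ t') init_state
      = (step Q xs ys ^^ (t' - t)) ((step Q xs ys ^^ t) init_state)"
    using assms(2) funpow_add[of "t' - t" t "step Q xs ys"] by simp
  ultimately show ?thesis
    using assms(1) by (simp add: outputs_within_def Let_def)
qed

text \<open>Cell 0 holds 1, which serves both as the input position of the number of products and as
  the decrement. Cell 1 counts the zeros still to be written; cell 2 keeps its initial 0 and is what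
  gets written. Entering at the test (position 5) makes m = 0 correct.\<close>

definition write_zeros :: "instr list" where
  "write_zeros =
     [IConst 0 1, IRead 1 0, Goto 5,
      Write 2, ISub 1 1 0, IfIPos 1 3]"

text \<open>Each round costs three steps, and the final failing test, which moves \<open>pc\<close>
  past the program, costs one more.\<close>

lemma write_zeros_loop:
  assumes "pc s = 5" "imem s 0 = 1" "imem s 1 = int k" "imem s 2 = 0"
  shows "halted write_zeros ((step write_zeros xs ys ^^ (3 * k + 1)) s) \<and>
    outp ((step write_zeros xs ys ^^ (3 * k + 1)) s) = outp s @ replicate k 0"
  using assms
proof (induction k arbitrary: s)
  case 0
  then show ?case by (simp add: step_def halted_def write_zeros_def)
next
  case (Suc k)
  let ?f = "step write_zeros xs ys"
  \<comment> \<open>One full round: the test succeeds because the counter is \<open>Suc k\<close>, a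
    zero is written, the counter drops to \<open>k\<close>, and control is back at the test.\<close>
  define s' where "s' = (?f ^^ 3) s"
  have s': "pc s' = 5" "imem s' 0 = 1" "imem s' 1 = int k" "imem s' 2 = 0"
    "outp s' = outp s @ [0]"
    using Suc.prems
    by (simp_all add: s'_def numeral_3_eq_3 step_def halted_def write_zeros_def set_imem_def)
  have "(?f ^^ (3 * Suc k + 1)) s = (?f ^^ (3 * k + 1)) s'"
    using funpow_add[of "3 * k + 1" 3 ?f] by (simp add: s'_def add.commute)
  then show ?case using Suc.IH[OF s'(1-4)] s'(5) by simp
qed

lemma outputs_within_write_zeros:
  assumes "lookup xs 1 = int k"
  shows "outputs_within write_zeros xs ys (3 * k + 4) (replicate k 0)"
proof -
  let ?f = "step write_zeros xs ys"
  \<comment> \<open>The three instructions before the loop test; they account for 3 of the 4 extra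
    steps.\<close>
  define s where "s = (?f ^^ 3) init_state"
  have "pc s = 5" "imem s 0 = 1" "imem s 1 = int k" "imem s 2 = 0" "outp s = []"
    using assms
    by (simp_all add: s_def init_state_def numeral_3_eq_3 step_def halted_def write_zeros_def
        set_imem_def)
  moreover have "(?f ^^ (3 * k + 4)) init_state = (?f ^^ (3 * k + 1)) s"
    using funpow_add[of "3 * k + 1" 3 ?f] by (simp add: s_def add.commute)
  ultimately show ?thesis
    using write_zeros_loop[of s k xs ys] by (simp add: outputs_within_def Let_def)
qed

theorem theorem1:
  "\<exists>(Q :: instr list) (T :: nat \<Rightarrow> nat).
     (\<lambda>k. real (T k)) \<in> O(\<lambda>k. real k) \<and>
     (\<forall>(I :: ('w, 'p) reallocation) ws ps.
        valid_instance I \<longrightarrow>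
        (\<forall>w\<in>warehouses I. cap_out I w = \<infinity> \<and> cap_in I w = \<infinity>) \<longrightarrow>
        enumerates ws (warehouses I) \<longrightarrow> enumerates ps (products I) \<longrightarrow>
        (\<exists>\<phi>. optimal_schedule I \<phi> \<and>
             outputs_within Q (int_input I ws ps) (real_input I ws ps)
               (T (card (products I) + card (warehouses I)))
               (map (\<lambda>p. int (\<phi> p)) ps)))"
\<comment> \<open>The witnesses stay schematic and are fixed by the \<open>show\<close> statements
  below: first \<open>T\<close>, then the schedule, then \<open>Q\<close>.\<close>
proof (intro exI conjI allI impI)
  show "(\<lambda>k. real (3 * k + 4)) \<in> O(\<lambda>k. real k)"
    \<comment> \<open>3k + 4 \<le> 7k once k \<ge> 1.\<close>
    by (rule bigoI[of _ 7], rule eventually_sequentiallyI[of 1]) auto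
next
  fix I :: "('w, 'p) reallocation" and ws ps
  assume "valid_instance I"
    and "\<forall>w\<in>warehouses I. cap_out I w = \<infinity> \<and> cap_in I w = \<infinity>"
  then show "optimal_schedule I (\<lambda>_. 0)" by (rule optimal_schedule_zero)
next
  fix I :: "('w, 'p) reallocation" and ws ps
  assume "enumerates ps (products I)"
  then have "card (products I) = length ps"
    by (metis enumerates_def distinct_card)
  moreover have "lookup (int_input I ws ps) 1 = int (length ps)"
    by (simp add: lookup_def int_input_def)
  \<comment> \<open>The run takes 3m + 4 steps, at most 3(m + n) + 4.\<close>
  ultimately show "outputs_within write_zeros (int_input I ws ps) (real_input I ws ps)
      (3 * (card (products I) + card (warehouses I)) + 4) (map (\<lambda>p. int 0) ps)"
    by (auto simp: map_replicate_const
        intro!: outputs_within_mono[OF outputs_within_write_zeros])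
qed

end
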